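(* Fix $\alpha\in(0,1)$ and $w=(w_1,\ldots,w_m)^\top\in(0,+\infty)^m$. Assume that the residuals $\widehat{s}_t=y_t-\widehat{\mu}(x_t)$, for $t\in\mathcal{D}_{\mathrm{calib}}\cup\{T+1\}$, are i.i.d., and that the residuals $\widehat{s}_t$, for $t\in\mathcal{D}_{\mathrm{calib}}$, follow some elliptical distribution over $\mathbb{R}^m$. Let $\widetilde{C}_1(x_{T+1}),\ldots,\widetilde{C}_m(x_{T+1})$ be the prediction intervals output by the hierarchical component-wise split conformal procedure (see context) run with the matrix $$P=P_w:=H\bigl(H^\top \mathrm{diag}(w)H\bigr)^{-1}H^\top\mathrm{diag}(w),$$ and let $\widehat{C}_1(x_{T+1}),\ldots,\widehat{C}_m(x_{T+1})$ be those output by the plain component-wise procedure, i.e., the same procedure run with $P=\mathrm{Id}_m$. Then $$\mathbb{E}\Bigl[\sum_{i=1}^m w_i\,\mathfrak{L}_1\bigl(\widetilde{C}_i(x_{T+1})\bigr)^2\Bigr]\ \leq\ \mathbb{E}\Bigl[\sum_{i=1}^m w_i\,\mathfrak{L}_1\bigl(\widehat{C}_i(x_{T+1})\bigr)^2\Bigr].$$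
   Context: Hierarchical data: let $m\geq 3$, $2\leq n<m$, $d\geq 1$, and let $H=\begin{bmatrix}\mathrm{Id}_n\\ H_{\mathrm{sub}}\end{bmatrix}$ be a fixed $m\times n$ real matrix, where $H_{\mathrm{sub}}$ is any $(m-n)\times n$ real matrix. The data are random pairs $(x_t,y_t)$, $1\leq t\leq T+1$, with $x_t\in\mathbb{R}^d$ and $y_t\in\mathbb{R}^m$, where all observations are coherent: $y_t=H\,(y_{t,1},\ldots,y_{t,n})^\top$, i.e., $y_t\in\mathrm{Im}(H)$. Expectations are with respect to all the data and may be infinite. $\mathfrak{L}_1$ denotes the Lebesgue measure on $\mathbb{R}$ (an unbounded interval has measure $+\infty$), and $\mathrm{diag}(w)$ is the diagonal matrix with diagonal $w$. Elliptical distributions: a random vector $z$ follows a spherical distribution over $\mathbb{R}^k$ if $z$ and $\Gamma z$ have the same distribution for all $k\times k$ orthogonal matrices $\Gamma$. An elliptical distribution over $\mathbb{R}^m$ is the distribution of a vector $c+Mz$, for a deterministic $c\in\mathbb{R}^m$, an $m\times k$ matrix $M$ such that $MM^\top$ has rank $k$, and a random vector $z$ following a spherical distribution over $\mathbb{R}^k$. Procedure run with a fixed $m\times m$ matrix $P$: the set of indices $\mathcal{D}_{\mathrm{train}}\cup\mathcal{D}_{\mathrm{calib}}=\{1,\ldots,T\}$ is a (deterministic) partition; let $T_{\mathrm{calib}}$ be the cardinality of $\mathcal{D}_{\mathrm{calib}}$. (1) A regression algorithm $\mathcal{A}$ (an arbitrary black box) outputs a function $\widehat{\mu}:\mathbb{R}^d\to\mathbb{R}^m$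 based on $(x_t,y_t)_{t\in\mathcal{D}_{\mathrm{train}}}$. Set $\widetilde{\mu}(\cdot)=P\widehat{\mu}(\cdot)$, with components $\widetilde{\mu}_i$. (2) For $t\in\mathcal{D}_{\mathrm{calib}}$, let $\widetilde{s}_t=y_t-\widetilde{\mu}(x_t)$, with components $\widetilde{s}_{t,i}$. (3) For each $i\in\{1,\ldots,m\}$, order $(\widetilde{s}_{t,i})_{t\in\mathcal{D}_{\mathrm{calib}}}$ into $\widetilde{s}_{(1),i}\leq\cdots\leq\widetilde{s}_{(T_{\mathrm{calib}}),i}$ and set $\widetilde{s}_{(0),i}=-\infty$, $\widetilde{s}_{(T_{\mathrm{calib}}+1),i}=+\infty$. (4) Output the prediction intervals $$\widetilde{C}_i(x_{T+1})=\Bigl[\widetilde{\mu}_i(x_{T+1})+\widetilde{s}_{(\lfloor (T_{\mathrm{calib}}+1)\alpha/2\rfloor),i}\,,\ \widetilde{\mu}_i(x_{T+1})+\widetilde{s}_{(\lceil (T_{\mathrm{calib}}+1)(1-\alpha/2)\rceil),i}\Bigr].$$ The two runs compared use the same $\alpha$, the same partition and the same algorithm $\mathcal{A}$ (hence the same $\widehat{\mu}$). *)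

theory Defs
  imports "HOL-Probability.Probability"
begin

subsection \<open>Spherical and elliptical distributions\<close>

text \<open>
  The dimension k in the definition of an elliptical distribution is existentially quantified, so
  it cannot be a type index. Vectors of dimension k are therefore functions in
  \<open>space (borel_k k)\<close>, and matrices with k columns are functions with a column index below k.
\<close>

abbreviation borel_k :: "nat \<Rightarrow> (nat \<Rightarrow> real) measure" where
  "borel_k k \<equiv> PiM {..<k} (\<lambda>_. borel)"

definition orthogonal_k :: "nat \<Rightarrow> (nat \<Rightarrow> nat \<Rightarrow> real) \<Rightarrow> bool" where
  "orthogonal_k k Q \<longleftrightarrow>
     (\<forall>i<k. \<forall>j<k. (\<Sum>l<k. Q l i * Q l j) = (if i = j then 1 else 0)) \<and>
     (\<forall>i<k. \<forall>j<k. (\<Sum>l<k. Q i l * Q j l) = (if i = j then 1 else 0))"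

definition apply_k :: "nat \<Rightarrow> (nat \<Rightarrow> nat \<Rightarrow> real) \<Rightarrow> (nat \<Rightarrow> real) \<Rightarrow> (nat \<Rightarrow> real)" where
  "apply_k k Q z = (\<lambda>i\<in>{..<k}. \<Sum>j<k. Q i j * z j)"

text \<open>Both notions are stated for laws: \<open>N\<close> is the law of the random vector z.\<close>

definition spherical :: "nat \<Rightarrow> (nat \<Rightarrow> real) measure \<Rightarrow> bool" where
  "spherical k N \<longleftrightarrow>
     prob_space N \<and> sets N = sets (borel_k k) \<and>
     (\<forall>Q. orthogonal_k k Q \<longrightarrow> distr N (borel_k k) (apply_k k Q) = N)"

definition elliptical :: "(real ^ 'm) measure \<Rightarrow> bool" where
  "elliptical D \<longleftrightarrow>
     (\<exists>k (c :: real ^ 'm) (L :: 'm \<Rightarrow> nat \<Rightarrow> real) N.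
        rank ((\<chi> i j. \<Sum>l<k. L i l * L j l) :: real ^ 'm ^ 'm) = k \<and>
        spherical k N \<and>
        D = distr N borel (\<lambda>z. \<chi> i. c $ i + (\<Sum>l<k. L i l * z l)))"

subsection \<open>Hierarchical structure\<close>

definition diag_mat :: "real ^ 'm \<Rightarrow> real ^ 'm ^ 'm" where
  "diag_mat w = (\<chi> i j. if i = j then w $ i else 0)"

text \<open>
  The rows are indexed by the sum type \<open>'n + 'k\<close>: left summands index the n rows of the identity
  block, right summands the m - n rows of the lower block.
\<close>

definition struct_mat :: "real ^ 'n ^ 'k \<Rightarrow> real ^ 'n ^ ('n + 'k)" where
  "struct_mat Hsub =
     (\<chi> i j. case i of Inl a \<Rightarrow> (if a = j then 1 else 0) | Inr b \<Rightarrow> Hsub $ b $ j)"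

definition proj_mat :: "real ^ 'n ^ 'm \<Rightarrow> real ^ 'm \<Rightarrow> real ^ 'm ^ 'm" where
  "proj_mat H w =
     H ** matrix_inv (transpose H ** diag_mat w ** H) ** transpose H ** diag_mat w"

subsection \<open>Component-wise split conformal prediction\<close>

type_synonym ('d, 'm) obs = "(real ^ 'd) \<times> (real ^ 'm)"

text \<open>A regression algorithm receives the family of its training observations.\<close>

type_synonym ('d, 'm) algorithm = "(nat \<Rightarrow> ('d, 'm) obs) \<Rightarrow> (real ^ 'd \<Rightarrow> real ^ 'm)"

definition fit :: "('d, 'm) algorithm \<Rightarrow> nat set \<Rightarrow> (nat \<Rightarrow> ('d, 'm) obs) \<Rightarrow>
    (real ^ 'd \<Rightarrow> real ^ 'm)" where
  "fit A Dtrain obs = A (restrict obs Dtrain)"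

definition residual :: "(real ^ 'd \<Rightarrow> real ^ 'm) \<Rightarrow> ('d, 'm) obs \<Rightarrow> real ^ 'm" where
  "residual \<mu> z = snd z - \<mu> (fst z)"

text \<open>
  The r-th smallest of the values of \<open>s\<close> over \<open>D\<close>, counted from 1 and with multiplicity;
  the value is \<open>-\<infinity>\<close> at rank 0 and \<open>\<infinity>\<close> at rank \<open>card D + 1\<close>.
\<close>

definition order_stat :: "(nat \<Rightarrow> real) \<Rightarrow> nat set \<Rightarrow> nat \<Rightarrow> ereal" where
  "order_stat s D r =
     (if r = 0 then -\<infinity>
      else if r \<le> card D
        then ereal (sorted_list_of_multiset (image_mset s (mset_set D)) ! (r - 1))
      else \<infinity>)"

definition lower_rank :: "real \<Rightarrow> nat \<Rightarrow> nat" where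
  "lower_rank \<alpha> Tc = nat \<lfloor>(real Tc + 1) * \<alpha> / 2\<rfloor>"

definition upper_rank :: "real \<Rightarrow> nat \<Rightarrow> nat" where
  "upper_rank \<alpha> Tc = nat \<lceil>(real Tc + 1) * (1 - \<alpha> / 2)\<rceil>"

definition pred_interval :: "real \<Rightarrow> nat set \<Rightarrow> nat set \<Rightarrow> ('d, 'm) algorithm \<Rightarrow>
    real ^ 'm ^ 'm \<Rightarrow> (nat \<Rightarrow> ('d, 'm) obs) \<Rightarrow> real ^ 'd \<Rightarrow> 'm \<Rightarrow> real set" where
  "pred_interval \<alpha> Dtrain Dcalib A P obs xnew i =
     (let \<mu> = (\<lambda>x. P *v fit A Dtrain obs x);
          s = (\<lambda>t. residual \<mu> (obs t) $ i);
          lo = order_stat s Dcalib (lower_rank \<alpha> (card Dcalib));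
          hi = order_stat s Dcalib (upper_rank \<alpha> (card Dcalib))
      in {u. ereal (\<mu> xnew $ i) + lo \<le> ereal u \<and> ereal u \<le> ereal (\<mu> xnew $ i) + hi})"

text \<open>Extended nonnegative integral, so that the expectation may be infinite.\<close>

definition expected_weighted_sq_length :: "'a measure \<Rightarrow> real ^ 'm \<Rightarrow> ('a \<Rightarrow> 'm \<Rightarrow> real set) \<Rightarrow> ennreal"
  where
  "expected_weighted_sq_length M w C =
     (\<integral>\<^sup>+ \<omega>. (\<Sum>i\<in>UNIV. ennreal (w $ i) * (emeasure lborel (C \<omega> i))\<^sup>2) \<partial>M)"

end

theory Submission
  imports Defs
begin

text \<open>
  By coherence \<open>P\<^sub>w y\<^sub>t = y\<^sub>t\<close>, so the scores of the projected run are \<open>P\<^sub>w\<close> applied to the plain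
  residuals, and each interval length is a difference of two order statistics of a linear functional
  \<open>b\<close> of the residuals \<open>c + L z\<close>. By rotation invariance \<open>b \<bullet> L z\<close> is distributed as
  \<open>\<parallel>L\<^sup>T b\<parallel>\<close> times one fixed real random variable; hence the expected squared length is
  \<open>\<parallel>L\<^sup>T b\<parallel>\<^sup>2 Q\<close>, where \<open>Q\<close>, possibly infinite, does not depend on \<open>b\<close>. Both sides are therefore
  \<open>Q\<close> times a sum, over the columns of \<open>L\<close>, of squared norms weighted by \<open>w\<close>, and \<open>P\<^sub>w\<close> is the
  orthogonal projection for that norm. If the lower rank is 0, both runs return the whole line.
\<close>

subsection \<open>Order statistics\<close>

text \<open>In a sorted list the entries at most \<open>a\<close> form a prefix, and an index lies
  in that prefix exactly when it is smaller than its length.\<close>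

lemma sorted_nth_le_iff:
  fixes a :: "'a::linorder"
  assumes "sorted xs" and "i < length xs"
  shows "xs ! i \<le> a \<longleftrightarrow> i < length (filter (\<lambda>x. x \<le> a) xs)"
  using assms
proof (induction xs arbitrary: i)
  case (Cons x xs)
  show ?case
  proof (cases "x \<le> a")
    case True
    then show ?thesis using Cons by (cases i) auto
  next
    case False
    then have "\<forall>z\<in>set (x # xs). \<not> z \<le> a" using Cons.prems by auto
    moreover from this have "\<not> (x # xs) ! i \<le> a" using Cons.prems(2) nth_mem by blast
    ultimately show ?thesis by (simp add: filter_False)
  qed
qed simp

text \<open>Real-valued and counted from 0, whereas \<open>order_stat\<close> is extended-real and
  counted from 1.\<close>

definition kth_smallest :: "(nat \<Rightarrow> real) \<Rightarrow> nat set \<Rightarrow> nat \<Rightarrow> real" where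
  "kth_smallest s D r = sorted_list_of_multiset (image_mset s (mset_set D)) ! r"

text \<open>Turns a bound on an order statistic into a count of sample points, from which
  measurability follows.\<close>

lemma kth_smallest_le_iff:
  assumes "finite D" and "r < card D"
  shows "kth_smallest s D r \<le> a \<longleftrightarrow> r < card {t \<in> D. s t \<le> a}"
proof -
  let ?xs = "sorted_list_of_multiset (image_mset s (mset_set D))"
  have len: "length ?xs = card D"
    by (metis mset_sorted_list_of_multiset size_image_mset size_mset size_mset_set)
  have "length (filter (\<lambda>x. x \<le> a) ?xs) = size (filter_mset (\<lambda>x. x \<le> a) (image_mset s (mset_set D)))"
    by (metis mset_filter mset_sorted_list_of_multiset size_mset)
  also have "\<dots> = card {t \<in> D. s t \<le> a}"
    using assms(1) by (simp add: filter_mset_image_mset)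
  finally show ?thesis
    unfolding kth_smallest_def using sorted_nth_le_iff[of ?xs r a] assms(2) len by simp
qed

lemma kth_smallest_cong:
  assumes "finite D" and "\<And>t. t \<in> D \<Longrightarrow> s t = s' t"
  shows "kth_smallest s D r = kth_smallest s' D r"
proof -
  have "image_mset s (mset_set D) = image_mset s' (mset_set D)"
    using assms by (intro image_mset_cong) simp
  then show ?thesis by (simp add: kth_smallest_def)
qed

text \<open>A nondecreasing map sends the sorted list of values to the sorted list of images. The
  slope 0 is included, for directions in which the residuals are degenerate.\<close>

lemma kth_smallest_affine:
  assumes "finite D" and "r < card D" and "0 \<le> b"
  shows "kth_smallest (\<lambda>t. a + b * s t) D r = a + b * kth_smallest s D r"
proof -
  let ?f = "\<lambda>u. a + b * u"
  let ?xs = "sorted_list_of_multiset (image_mset s (mset_set D))"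
  have len: "length ?xs = card D"
    by (metis mset_sorted_list_of_multiset size_image_mset size_mset size_mset_set)
  have "sorted (map ?f ?xs)"
    using assms(3) by (auto simp: sorted_map mult_left_mono intro: sorted_wrt_mono_rel[of _ "(\<le>)"])
  moreover have "mset (map ?f ?xs) = image_mset (\<lambda>t. ?f (s t)) (mset_set D)"
    by (simp add: multiset.map_comp comp_def)
  ultimately have "sorted_list_of_multiset (image_mset (\<lambda>t. ?f (s t)) (mset_set D)) = map ?f ?xs"
    by (metis sorted_list_of_multiset_mset sorted_sort_id)
  then show ?thesis using len assms(2) by (simp add: kth_smallest_def)
qed

lemma borel_measurable_kth_smallest:
  assumes "finite D" and "r < card D"
  shows "(\<lambda>s. kth_smallest s D r) \<in> borel_measurable (PiM D (\<lambda>_. borel))"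
  unfolding borel_measurable_iff_le
proof
  fix a :: real
  let ?P = "PiM D (\<lambda>_. borel) :: (nat \<Rightarrow> real) measure"
  have eq: "real (card {t \<in> D. s t \<le> a}) = (\<Sum>t\<in>D. indicator {..a} (s t))" for s :: "nat \<Rightarrow> real"
  proof -
    have "(\<Sum>t\<in>D. indicator {..a} (s t)) = (\<Sum>t\<in>D. if s t \<le> a then 1 else 0 :: real)"
      by (intro sum.cong) (auto simp: indicator_def)
    also have "\<dots> = real (card {t \<in> D. s t \<le> a})"
      using assms(1) by (simp add: sum.If_cases Int_def)
    finally show ?thesis by simp
  qed
  \<comment> \<open>The count is written as a sum of indicators of single coordinates, so each
    sublevel set is visibly measurable.\<close>
  have "kth_smallest s D r \<le> a \<longleftrightarrow> real r < (\<Sum>t\<in>D. indicator {..a} (s t))" for s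
    unfolding kth_smallest_le_iff[OF assms] eq[symmetric] by simp
  moreover have "{s \<in> space ?P. real r < (\<Sum>t\<in>D. indicator {..a} (s t))} \<in> sets ?P"
    by measurable
  ultimately show "{s \<in> space ?P. kth_smallest s D r \<le> a} \<in> sets ?P" by simp
qed

text \<open>\<open>ennreal\<close> sends negative reals to 0, which agrees with the length of an
  interval whose endpoints are in the wrong order.\<close>

definition sq_spread :: "nat set \<Rightarrow> nat \<Rightarrow> nat \<Rightarrow> (nat \<Rightarrow> real) \<Rightarrow> ennreal" where
  "sq_spread D p q s = (ennreal (kth_smallest s D q - kth_smallest s D p))\<^sup>2"

lemma sq_spread_cong:
  assumes "finite D" and "\<And>t. t \<in> D \<Longrightarrow> s t = s' t"
  shows "sq_spread D p q s = sq_spread D p q s'"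
  unfolding sq_spread_def using kth_smallest_cong[OF assms] by simp

lemma sq_spread_affine:
  assumes "finite D" and "p < card D" and "q < card D" and "0 \<le> b"
  shows "sq_spread D p q (\<lambda>t. a + b * s t) = ennreal (b\<^sup>2) * sq_spread D p q s"
proof -
  have "kth_smallest (\<lambda>t. a + b * s t) D q - kth_smallest (\<lambda>t. a + b * s t) D p
      = b * (kth_smallest s D q - kth_smallest s D p)"
    using assms by (simp add: kth_smallest_affine algebra_simps)
  then show ?thesis
    using assms(4) by (simp add: sq_spread_def ennreal_mult' power_mult_distrib ennreal_power)
qed

lemma borel_measurable_sq_spread:
  assumes "finite D" and "p < card D" and "q < card D"
  shows "sq_spread D p q \<in> borel_measurable (PiM D (\<lambda>_. borel))"
  using borel_measurable_kth_smallest[OF assms(1,2)] borel_measurable_kth_smallest[OF assms(1,3)]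
  unfolding sq_spread_def[abs_def] by measurable

text \<open>By independence the joint law of the sample is a product, namely the image of the
  product of copies of \<open>G\<close> under a coordinatewise affine map. The shift cancels in the
  spread and the slope factors out, so the remaining integral depends on neither \<open>a\<close>
  nor \<open>b\<close>.\<close>

lemma nn_integral_iid_sq_spread:
  assumes "prob_space M" and D: "finite D" "p < card D" "q < card D"
    and indep: "prob_space.indep_vars M (\<lambda>_. borel) X D"
    and G: "prob_space G" "sets G = sets borel"
    and law: "\<And>t. t \<in> D \<Longrightarrow> distr M borel (X t) = distr G borel (\<lambda>u. a + b * u)"
    and "0 \<le> b"
  shows "(\<integral>\<^sup>+ \<omega>. sq_spread D p q (\<lambda>t. X t \<omega>) \<partial>M)
       = ennreal (b\<^sup>2) * (\<integral>\<^sup>+ s. sq_spread D p q s \<partial>PiM D (\<lambda>_. G))"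
proof -
  interpret prob_space M by fact
  have "D \<noteq> {}" using D by auto
  \<comment> \<open>The library lemma on images of product measures wants a probability space as codomain.\<close>
  let ?R = "return borel (0 :: real)"
  let ?B = "PiM D (\<lambda>_. borel) :: (nat \<Rightarrow> real) measure"
  have [measurable]: "X t \<in> borel_measurable M" if "t \<in> D" for t
    using indep that by (auto simp: indep_vars_def)
  have F: "sq_spread D p q \<in> borel_measurable ?B"
    by (rule borel_measurable_sq_spread[OF D])
  have Gb: "sets (PiM D (\<lambda>_. G)) = sets ?B"
    using G(2) by (intro sets_PiM_cong) auto
  have m: "(\<lambda>u. a + b * u) \<in> borel_measurable G"
    unfolding measurable_cong_sets[OF G(2) refl] by measurable
  have mX: "(\<lambda>\<omega>. \<lambda>t\<in>D. X t \<omega>) \<in> measurable M ?B" by measurable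
  have mA: "(\<lambda>s. \<lambda>t\<in>D. a + b * s t) \<in> measurable (PiM D (\<lambda>_. G)) ?B"
    unfolding measurable_cong_sets[OF Gb refl] by measurable
  have "distr M ?B (\<lambda>\<omega>. \<lambda>t\<in>D. X t \<omega>) = PiM D (\<lambda>t. distr M borel (X t))"
    using indep_vars_iff_distr_eq_PiM'[OF \<open>D \<noteq> {}\<close>, of X "\<lambda>_. borel"] indep by simp
  also have "\<dots> = PiM D (\<lambda>_. distr G borel (\<lambda>u. a + b * u))"
    by (intro PiM_cong law refl)
  also have "\<dots> = PiM D (\<lambda>_. distr G ?R (\<lambda>u. a + b * u))"
    by (intro PiM_cong distr_cong refl) simp_all
  also have "\<dots> = distr (PiM D (\<lambda>_. G)) (PiM D (\<lambda>_. ?R)) (compose D (\<lambda>u. a + b * u))"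
    using D(1) G(1) m
    by (intro distr_PiM_finite_prob_space'[symmetric]) (auto intro: prob_space_return)
  also have "\<dots> = distr (PiM D (\<lambda>_. G)) ?B (compose D (\<lambda>u. a + b * u))"
    by (intro distr_cong sets_PiM_cong refl) simp_all
  also have "compose D (\<lambda>u. a + b * u) = (\<lambda>s. \<lambda>t\<in>D. a + b * s t)"
    by (simp add: compose_def fun_eq_iff)
  finally have eq: "distr M ?B (\<lambda>\<omega>. \<lambda>t\<in>D. X t \<omega>)
      = distr (PiM D (\<lambda>_. G)) ?B (\<lambda>s. \<lambda>t\<in>D. a + b * s t)" .
  have "(\<integral>\<^sup>+ \<omega>. sq_spread D p q (\<lambda>t. X t \<omega>) \<partial>M)
      = (\<integral>\<^sup>+ \<omega>. sq_spread D p q (\<lambda>t\<in>D. X t \<omega>) \<partial>M)"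
    by (intro nn_integral_cong sq_spread_cong D) simp
  also have "\<dots> = (\<integral>\<^sup>+ s. sq_spread D p q s \<partial>distr M ?B (\<lambda>\<omega>. \<lambda>t\<in>D. X t \<omega>))"
    using mX F by (simp add: nn_integral_distr)
  also have "\<dots> = (\<integral>\<^sup>+ s. sq_spread D p q (\<lambda>t\<in>D. a + b * s t) \<partial>PiM D (\<lambda>_. G))"
    unfolding eq using mA F by (simp add: nn_integral_distr)
  also have "\<dots> = (\<integral>\<^sup>+ s. ennreal (b\<^sup>2) * sq_spread D p q s \<partial>PiM D (\<lambda>_. G))"
  proof (intro nn_integral_cong)
    fix s :: "nat \<Rightarrow> real"
    have "sq_spread D p q (\<lambda>t\<in>D. a + b * s t) = sq_spread D p q (\<lambda>t. a + b * s t)"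
      by (intro sq_spread_cong D) simp
    then show "sq_spread D p q (\<lambda>t\<in>D. a + b * s t) = ennreal (b\<^sup>2) * sq_spread D p q s"
      using sq_spread_affine[OF D \<open>0 \<le> b\<close>] by simp
  qed
  also have "\<dots> = ennreal (b\<^sup>2) * (\<integral>\<^sup>+ s. sq_spread D p q s \<partial>PiM D (\<lambda>_. G))"
    using F Gb by (intro nn_integral_cmult) (simp cong: measurable_cong_sets)
  finally show ?thesis .
qed

subsection \<open>One-dimensional marginals of spherical and elliptical laws\<close>

lemma sum_delta_mult:
  fixes f :: "nat \<Rightarrow> real"
  assumes "i < k"
  shows "(\<Sum>l<k. (if l = i then 1 else 0) * f l) = f i"
    and "(\<Sum>l<k. f l * (if l = i then 1 else 0)) = f i"
proof -
  have "(\<Sum>l<k. (if l = i then 1 else 0) * f l) = (\<Sum>l<k. if l = i then f l else 0)"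
    by (intro sum.cong) auto
  then show "(\<Sum>l<k. (if l = i then 1 else 0) * f l) = f i" using assms by simp
  then show "(\<Sum>l<k. f l * (if l = i then 1 else 0)) = f i" by (simp add: mult.commute)
qed

text \<open>Entries of the reflection across the hyperplane orthogonal to \<open>v\<close>.\<close>

definition householder :: "nat \<Rightarrow> (nat \<Rightarrow> real) \<Rightarrow> nat \<Rightarrow> nat \<Rightarrow> real" where
  "householder k v i j = (if i = j then 1 else 0) - 2 / (\<Sum>l<k. v l * v l) * v i * v j"

lemma orthogonal_householder:
  assumes "(\<Sum>l<k. v l * v l) \<noteq> 0"
  shows "orthogonal_k k (householder k v)"
proof -
  define c where "c = 2 / (\<Sum>l<k. v l * v l)"
  have c: "c * (\<Sum>l<k. v l * v l) = 2" using assms by (simp add: c_def)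
  have sym: "householder k v i j = householder k v j i" for i j
    by (simp add: householder_def)
  have *: "(\<Sum>l<k. householder k v l i * householder k v l j) = (if i = j then 1 else 0)"
    if "i < k" "j < k" for i j
  proof -
    have "(\<Sum>l<k. householder k v l i * householder k v l j)
        = (\<Sum>l<k. (if l = i then 1 else 0) * (if l = j then 1 else 0)
             - (if l = i then 1 else 0) * (c * v l * v j)
             - (if l = j then 1 else 0) * (c * v l * v i)
             + c * v i * c * v j * (v l * v l))"
      unfolding householder_def c_def[symmetric] by (intro sum.cong) (auto simp: algebra_simps)
    also have "\<dots> = (if i = j then 1 else 0) - c * v i * v j - c * v j * v i
        + c * v i * c * v j * (\<Sum>l<k. v l * v l)"
      using that by (simp only: sum.distrib sum_subtractf sum_distrib_left[symmetric] sum_delta_mult(1))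
    \<comment> \<open>One factor \<open>c\<close> times the squared norm of \<open>v\<close> is 2,
      so this term cancels the two cross terms.\<close>
    also have "c * v i * c * v j * (\<Sum>l<k. v l * v l) = c * v i * v j * (c * (\<Sum>l<k. v l * v l))"
      by simp
    finally show ?thesis unfolding c by simp
  qed
  then show ?thesis unfolding orthogonal_k_def by (metis (no_types, lifting) sym sum.cong)
qed

text \<open>Two vectors of equal norm are exchanged by the reflection along their difference, and
  the law \<open>N\<close> is invariant under that reflection.\<close>

lemma spherical_linear_law_eq:
  assumes N: "spherical k N"
    and norms: "(\<Sum>l<k. (a l)\<^sup>2) = (\<Sum>l<k. (b l)\<^sup>2)"
  shows "distr N borel (\<lambda>z. \<Sum>l<k. a l * z l) = distr N borel (\<lambda>z. \<Sum>l<k. b l * z l)"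
proof (cases "\<forall>l<k. a l = b l")
  case True
  then show ?thesis by (metis (no_types, lifting) lessThan_iff sum.cong)
next
  \<comment> \<open>The reflection requires \<open>v\<close> to be nonzero, hence the separate case
    of equal coefficients.\<close>
  case False
  define v where "v l = a l - b l" for l
  define S where "S = (\<Sum>l<k. v l * v l)"
  let ?Q = "householder k v"
  have setsN: "sets N = sets (borel_k k)" using N by (simp add: spherical_def)
  have "S \<noteq> 0"
    using False unfolding S_def by (subst sum_nonneg_eq_0_iff) (auto simp: v_def)
  then have "orthogonal_k k ?Q" unfolding S_def by (rule orthogonal_householder)
  then have inv: "distr N (borel_k k) (apply_k k ?Q) = N" using N by (simp add: spherical_def)
  \<comment> \<open>The subtracted difference of squared norms is 0, so the reflection moves
    \<open>a\<close> by exactly \<open>v\<close>.\<close>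
  have "S = (\<Sum>l<k. 2 * (v l * a l)) - ((\<Sum>l<k. (a l)\<^sup>2) - (\<Sum>l<k. (b l)\<^sup>2))"
    unfolding S_def sum_subtractf[symmetric] v_def
    by (intro sum.cong) (auto simp: power2_eq_square algebra_simps)
  then have S: "2 * (\<Sum>l<k. v l * a l) = S" using norms by (simp add: sum_distrib_left)
  have Qa: "(\<Sum>i<k. a i * ?Q i j) = b j" if "j < k" for j
  proof -
    have "(\<Sum>i<k. a i * ?Q i j)
        = (\<Sum>i<k. a i * (if i = j then 1 else 0) - v j * (2 / S) * (v i * a i))"
      unfolding householder_def S_def[symmetric] by (intro sum.cong) (auto simp: algebra_simps)
    also have "\<dots> = a j - v j * (2 / S) * (\<Sum>i<k. v i * a i)"
      using that by (simp only: sum_subtractf sum_distrib_left[symmetric] sum_delta_mult(2))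
    also have "\<dots> = a j - v j * (2 * (\<Sum>i<k. v i * a i) / S)" by simp
    also have "\<dots> = b j" unfolding S using \<open>S \<noteq> 0\<close> by (simp add: v_def)
    finally show ?thesis .
  qed
  have lin: "(\<lambda>z. \<Sum>l<k. a l * z l) \<in> borel_measurable (borel_k k)" by measurable
  have mQ: "apply_k k ?Q \<in> measurable N (borel_k k)"
    unfolding measurable_cong_sets[OF setsN refl] apply_k_def[abs_def] by measurable
  have comp: "(\<Sum>i<k. a i * apply_k k ?Q z i) = (\<Sum>j<k. b j * z j)" for z
  proof -
    have "(\<Sum>i<k. a i * apply_k k ?Q z i) = (\<Sum>i<k. \<Sum>j<k. a i * ?Q i j * z j)"
      by (intro sum.cong) (auto simp: apply_k_def sum_distrib_left mult.assoc)
    also have "\<dots> = (\<Sum>j<k. \<Sum>i<k. a i * ?Q i j * z j)" by (rule sum.swap)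
    also have "\<dots> = (\<Sum>j<k. (\<Sum>i<k. a i * ?Q i j) * z j)" by (simp add: sum_distrib_right)
    also have "\<dots> = (\<Sum>j<k. b j * z j)" using Qa by simp
    finally show ?thesis .
  qed
  have "distr N borel (\<lambda>z. \<Sum>l<k. a l * z l)
      = distr (distr N (borel_k k) (apply_k k ?Q)) borel (\<lambda>z. \<Sum>l<k. a l * z l)"
    by (simp add: inv)
  also have "\<dots> = distr N borel (\<lambda>z. \<Sum>l<k. b l * z l)"
    using lin mQ by (simp add: distr_distr comp_def comp)
  finally show ?thesis .
qed

text \<open>The vector \<open>a\<close> has the same norm as its norm times the first unit vector,
  so every linear functional is a rescaling of the first coordinate.\<close>

lemma spherical_linear_law:
  assumes N: "spherical k N"
  obtains G :: "real measure" where "prob_space G" "sets G = sets borel"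
    "\<And>a. distr N borel (\<lambda>z. \<Sum>l<k. a l * z l)
        = distr G borel (\<lambda>u. sqrt (\<Sum>l<k. (a l)\<^sup>2) * u)"
proof
  \<comment> \<open>The sum is the first coordinate of z, and 0 if k = 0.\<close>
  let ?e = "\<lambda>z :: nat \<Rightarrow> real. \<Sum>l<k. (if l = 0 then 1 else 0) * z l"
  let ?G = "distr N borel ?e"
  have setsN: "sets N = sets (borel_k k)" and "prob_space N"
    using N by (auto simp: spherical_def)
  have me: "?e \<in> borel_measurable N"
    unfolding measurable_cong_sets[OF setsN refl] by measurable
  show "prob_space ?G" using \<open>prob_space N\<close> me by (rule prob_space.prob_space_distr)
  show "sets ?G = sets borel" by simp
  fix a :: "nat \<Rightarrow> real"
  define r where "r = sqrt (\<Sum>l<k. (a l)\<^sup>2)"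
  have mr: "(\<lambda>u. r * u) \<in> borel_measurable borel" by measurable
  have r: "r\<^sup>2 = (\<Sum>l<k. (a l)\<^sup>2)" by (simp add: r_def sum_nonneg)
  have "(\<Sum>l<k. (r * (if l = 0 then 1 else 0))\<^sup>2) = (\<Sum>l<k. (a l)\<^sup>2)"
  proof (cases "k = 0")
    case False
    have "(\<Sum>l<k. (r * (if l = 0 then 1 else 0))\<^sup>2) = (\<Sum>l<k. if l = 0 then r\<^sup>2 else 0)"
      by (intro sum.cong) auto
    then show ?thesis using False r by simp
  qed simp
  then have "distr N borel (\<lambda>z. \<Sum>l<k. a l * z l)
      = distr N borel (\<lambda>z. \<Sum>l<k. r * (if l = 0 then 1 else 0) * z l)"
    by (intro spherical_linear_law_eq[OF N]) simp
  also have "\<dots> = distr N borel (\<lambda>z. r * ?e z)"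
    by (intro distr_cong refl) (simp add: sum_distrib_left mult.assoc)
  also have "\<dots> = distr ?G borel (\<lambda>u. r * u)"
    using distr_distr[OF mr me] by (simp only: comp_def)
  finally show "distr N borel (\<lambda>z. \<Sum>l<k. a l * z l)
      = distr ?G borel (\<lambda>u. sqrt (\<Sum>l<k. (a l)\<^sup>2) * u)"
    unfolding r_def .
qed

text \<open>Pairing \<open>c + L z\<close> with \<open>b\<close> gives a constant plus a linear
  functional of \<open>z\<close> with coefficients \<open>b \<bullet> e l\<close>, where
  \<open>e l\<close> is column \<open>l\<close> of \<open>L\<close>. The same \<open>G\<close>,
  \<open>c\<close> and \<open>e\<close> serve all directions \<open>b\<close>.\<close>

lemma elliptical_linear_law:
  fixes D :: "(real ^ 'm) measure"
  assumes "elliptical D"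
  obtains k c and e :: "nat \<Rightarrow> real ^ 'm" and G :: "real measure"
  where "prob_space G" "sets G = sets borel"
    "\<And>b. distr D borel (\<lambda>v. b \<bullet> v)
        = distr G borel (\<lambda>u. b \<bullet> c + sqrt (\<Sum>l<k. (b \<bullet> e l)\<^sup>2) * u)"
proof -
  obtain k c and L :: "'m \<Rightarrow> nat \<Rightarrow> real" and N where N: "spherical k N"
    and D: "D = distr N borel (\<lambda>z. \<chi> i. c $ i + (\<Sum>l<k. L i l * z l))"
    using assms unfolding elliptical_def by blast
  obtain G :: "real measure" where G: "prob_space G" "sets G = sets borel"
    and law: "\<And>a. distr N borel (\<lambda>z. \<Sum>l<k. a l * z l)
        = distr G borel (\<lambda>u. sqrt (\<Sum>l<k. (a l)\<^sup>2) * u)"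
    using spherical_linear_law[OF N] by blast
  define e :: "nat \<Rightarrow> real ^ 'm" where "e l = (\<chi> j. L j l)" for l
  have setsN: "sets N = sets (borel_k k)" using N by (simp add: spherical_def)
  have [measurable]: "(\<lambda>z. z l) \<in> borel_measurable N" if "l \<in> {..<k}" for l
    unfolding measurable_cong_sets[OF setsN refl] using that by measurable
  have emb: "(\<chi> i. c $ i + (\<Sum>l<k. L i l * z l)) = c + (\<Sum>l<k. z l *\<^sub>R e l)" for z
    by (simp add: vec_eq_iff e_def mult.commute)
  have mz: "(\<lambda>z. c + (\<Sum>l<k. z l *\<^sub>R e l)) \<in> borel_measurable N" by measurable
  have "distr D borel (\<lambda>v. b \<bullet> v)
      = distr G borel (\<lambda>u. b \<bullet> c + sqrt (\<Sum>l<k. (b \<bullet> e l)\<^sup>2) * u)" for b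
  proof -
    have "distr D borel (\<lambda>v. b \<bullet> v) = distr N borel (\<lambda>z. b \<bullet> c + (\<Sum>l<k. (b \<bullet> e l) * z l))"
      unfolding D emb using mz
      by (simp add: distr_distr comp_def inner_add_right inner_sum_right mult.commute)
    also have "\<dots> = distr (distr N borel (\<lambda>z. \<Sum>l<k. (b \<bullet> e l) * z l)) borel (\<lambda>u. b \<bullet> c + u)"
      by (subst distr_distr) (auto simp: comp_def)
    also have "\<dots> = distr G borel (\<lambda>u. b \<bullet> c + sqrt (\<Sum>l<k. (b \<bullet> e l)\<^sup>2) * u)"
      unfolding law by (subst distr_distr) (auto simp: comp_def G(2) cong: measurable_cong_sets)
    finally show ?thesis .
  qed
  with G show ?thesis using that by blast
qed

subsection \<open>The weighted projection\<close>

lemma diag_mat_mult_vec: "diag_mat w *v v = (\<chi> i. w $ i * v $ i)"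
  by (simp add: vec_eq_iff diag_mat_def matrix_vector_mult_def if_distrib if_distribR
      sum.delta cong: if_cong)

text \<open>The identity block recovers \<open>v\<close> from its image, which makes the structural
  matrix injective.\<close>

lemma struct_mat_mult_Inl: "(struct_mat Hsub *v v) $ Inl a = v $ a"
  by (simp add: struct_mat_def matrix_vector_mult_def if_distrib if_distribR
      sum.delta cong: if_cong)

lemma matrix_inv_cancel:
  fixes A :: "real ^ 'n ^ 'n"
  assumes "invertible A"
  shows "A ** matrix_inv A = mat 1" and "matrix_inv A ** A = mat 1"
  using someI_ex[OF assms[unfolded invertible_def]] by (auto simp: matrix_inv_def)

lemma inner_transpose_mult:
  fixes A :: "real ^ 'n ^ 'm"
  shows "v \<bullet> (transpose A *v u) = (A *v v) \<bullet> u"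
  by (metis dot_lmul_matrix vector_transpose_matrix)

text \<open>The quadratic form of this matrix at \<open>v\<close> is the weighted squared norm of
  \<open>H *v v\<close>; positive weights and injectivity make the kernel trivial.\<close>

lemma invertible_weighted_gram:
  fixes H :: "real ^ 'n ^ 'm"
  assumes w: "\<And>i. 0 < w $ i" and inj: "\<And>v. H *v v = 0 \<Longrightarrow> v = 0"
  shows "invertible (transpose H ** diag_mat w ** H)"
proof -
  have "v = 0" if v: "(transpose H ** diag_mat w ** H) *v v = 0" for v
  proof -
    have "0 = v \<bullet> (transpose H *v (diag_mat w *v (H *v v)))"
      using v by (simp add: matrix_vector_mul_assoc matrix_mul_assoc)
    also have "\<dots> = (H *v v) \<bullet> (diag_mat w *v (H *v v))"
      by (rule inner_transpose_mult)
    also have "\<dots> = (\<Sum>i\<in>UNIV. w $ i * ((H *v v) $ i)\<^sup>2)"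
      by (simp add: diag_mat_mult_vec inner_vec_def power2_eq_square mult_ac)
    finally have "(\<Sum>i\<in>UNIV. w $ i * ((H *v v) $ i)\<^sup>2) = 0" by simp
    then have "\<forall>i. w $ i * ((H *v v) $ i)\<^sup>2 = 0"
      using w by (subst (asm) sum_nonneg_eq_0_iff) (auto simp: less_imp_le)
    then have "H *v v = 0" using less_imp_neq[OF w] by (simp add: vec_eq_iff)
    then show ?thesis by (rule inj)
  qed
  then show ?thesis
    by (metis invertible_left_inverse matrix_left_invertible_ker)
qed

text \<open>The factor to the right of the inverse, multiplied by \<open>H\<close>, is the Gram
  matrix itself and cancels. Hence coherent observations are left unchanged.\<close>

lemma proj_mat_fixes_range:
  fixes H :: "real ^ 'n ^ 'm"
  assumes "invertible (transpose H ** diag_mat w ** H)"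
  shows "proj_mat H w *v (H *v v) = H *v v"
proof -
  let ?K = "transpose H ** diag_mat w ** H"
  have "proj_mat H w ** H = H ** (matrix_inv ?K ** ?K)"
    by (simp add: proj_mat_def matrix_mul_assoc)
  also have "\<dots> = H" using matrix_inv_cancel(2)[OF assms] by simp
  finally show ?thesis by (simp add: matrix_vector_mul_assoc)
qed

text \<open>Pythagoras: \<open>v - P\<^sub>w v\<close> is orthogonal to the range of \<open>H\<close> for the inner product weighted by \<open>w\<close>.\<close>

lemma proj_mat_contraction:
  fixes H :: "real ^ 'n ^ 'm"
  assumes K: "invertible (transpose H ** diag_mat w ** H)" and w: "\<And>i. 0 < w $ i"
  shows "(\<Sum>i\<in>UNIV. w $ i * ((proj_mat H w *v v) $ i)\<^sup>2) \<le> (\<Sum>i\<in>UNIV. w $ i * (v $ i)\<^sup>2)"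
proof -
  let ?K = "transpose H ** diag_mat w ** H"
  define z where "z = matrix_inv ?K *v (transpose H *v (diag_mat w *v v))"
  define u where "u = proj_mat H w *v v"
  have u: "u = H *v z"
    by (simp add: u_def z_def proj_mat_def matrix_vector_mul_assoc matrix_mul_assoc)
  \<comment> \<open>These are the normal equations of weighted least squares; pairing them with
    \<open>z\<close> gives the orthogonality relation.\<close>
  have "transpose H *v (diag_mat w *v u) = (?K ** matrix_inv ?K) *v (transpose H *v (diag_mat w *v v))"
    by (simp add: u z_def matrix_vector_mul_assoc matrix_mul_assoc)
  then have "transpose H *v (diag_mat w *v u) = transpose H *v (diag_mat w *v v)"
    using matrix_inv_cancel(1)[OF K] by simp
  then have "u \<bullet> (diag_mat w *v u) = u \<bullet> (diag_mat w *v v)"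
    unfolding u by (simp only: inner_transpose_mult[symmetric])
  then have orth: "(\<Sum>i\<in>UNIV. w $ i * (u $ i * u $ i)) = (\<Sum>i\<in>UNIV. w $ i * (u $ i * v $ i))"
    by (simp add: diag_mat_mult_vec inner_vec_def mult_ac)
  have "0 \<le> (\<Sum>i\<in>UNIV. w $ i * (v $ i - u $ i)\<^sup>2)"
    using w by (intro sum_nonneg) (simp add: less_imp_le)
  also have "\<dots> = (\<Sum>i\<in>UNIV. w $ i * (v $ i)\<^sup>2 - 2 * (w $ i * (u $ i * v $ i)) + w $ i * (u $ i * u $ i))"
    by (intro sum.cong) (auto simp: power2_eq_square algebra_simps)
  also have "\<dots> = (\<Sum>i\<in>UNIV. w $ i * (v $ i)\<^sup>2) - 2 * (\<Sum>i\<in>UNIV. w $ i * (u $ i * v $ i))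
      + (\<Sum>i\<in>UNIV. w $ i * (u $ i * u $ i))"
    by (simp only: sum.distrib sum_subtractf sum_distrib_left[symmetric])
  also have "\<dots> = (\<Sum>i\<in>UNIV. w $ i * (v $ i)\<^sup>2) - (\<Sum>i\<in>UNIV. w $ i * (u $ i)\<^sup>2)"
    unfolding orth[symmetric] by (simp add: power2_eq_square)
  finally show ?thesis by (simp add: u_def)
qed

subsection \<open>Interval lengths\<close>

text \<open>The two ranks add up to \<open>n + 1\<close>, because the ceiling of an integer minus
  \<open>z\<close> is that integer minus the floor of \<open>z\<close>. They therefore leave the
  range from 1 to \<open>n\<close> together.\<close>

lemma ranks_cases [consumes 2, case_names unbounded bounded]:
  assumes "0 < \<alpha>" and "\<alpha> < 1"
  obtains (unbounded) "lower_rank \<alpha> n = 0" "upper_rank \<alpha> n = n + 1"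
  | (bounded) "0 < lower_rank \<alpha> n" "lower_rank \<alpha> n \<le> n"
      "0 < upper_rank \<alpha> n" "upper_rank \<alpha> n \<le> n"
proof -
  define z where "z = (real n + 1) * \<alpha> / 2"
  have z: "0 \<le> z" "z < real n + 1"
  proof -
    have "(real n + 1) * \<alpha> < real n + 1"
      using mult_strict_left_mono[OF assms(2), of "real n + 1"] by simp
    moreover have "0 \<le> (real n + 1) * \<alpha>" using assms by simp
    ultimately show "0 \<le> z" "z < real n + 1" unfolding z_def by linarith+
  qed
  have fl: "0 \<le> \<lfloor>z\<rfloor>" "\<lfloor>z\<rfloor> < int n + 1" using z by (simp, linarith)
  have "(real n + 1) * (1 - \<alpha> / 2) = real_of_int (int n + 1) - z"
    by (simp add: z_def algebra_simps add_divide_distrib)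
  then have "\<lceil>(real n + 1) * (1 - \<alpha> / 2)\<rceil> = int n + 1 - \<lfloor>z\<rfloor>"
    unfolding ceiling_def by simp linarith
  then have "upper_rank \<alpha> n = nat (int n + 1 - \<lfloor>z\<rfloor>)" and "lower_rank \<alpha> n = nat \<lfloor>z\<rfloor>"
    by (simp_all add: upper_rank_def lower_rank_def z_def)
  moreover have "0 < nat \<lfloor>z\<rfloor>" "nat \<lfloor>z\<rfloor> \<le> n" "0 < nat (int n + 1 - \<lfloor>z\<rfloor>)"
    "nat (int n + 1 - \<lfloor>z\<rfloor>) \<le> n" if "\<lfloor>z\<rfloor> \<noteq> 0"
    using fl that by linarith+
  ultimately show ?thesis using that by (cases "\<lfloor>z\<rfloor> = 0") (simp_all add: nat_add_distrib)
qed

lemma pred_interval_unbounded: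
  assumes "lower_rank \<alpha> (card Dcalib) = 0" and "upper_rank \<alpha> (card Dcalib) = card Dcalib + 1"
  shows "pred_interval \<alpha> Dtrain Dcalib A P obs x i = UNIV"
  using assms by (simp add: pred_interval_def order_stat_def Let_def)

text \<open>Both endpoints are shifted by the same prediction, so the length does not depend on the
  new point. The subtractions of 1 pass from ranks counted from 1 to ranks counted from 0.\<close>

lemma emeasure_pred_interval:
  assumes "0 < lower_rank \<alpha> (card D)" "lower_rank \<alpha> (card D) \<le> card D"
    and "0 < upper_rank \<alpha> (card D)" "upper_rank \<alpha> (card D) \<le> card D"
  shows "(emeasure lborel (pred_interval \<alpha> Dtrain D A P obs x i))\<^sup>2
       = sq_spread D (lower_rank \<alpha> (card D) - 1) (upper_rank \<alpha> (card D) - 1)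
           (\<lambda>t. (snd (obs t) - P *v fit A Dtrain obs (fst (obs t))) $ i)"
proof -
  let ?s = "\<lambda>t. (snd (obs t) - P *v fit A Dtrain obs (fst (obs t))) $ i"
  let ?m = "(P *v fit A Dtrain obs x) $ i"
  let ?l = "kth_smallest ?s D (lower_rank \<alpha> (card D) - 1)"
  let ?u = "kth_smallest ?s D (upper_rank \<alpha> (card D) - 1)"
  have "pred_interval \<alpha> Dtrain D A P obs x i = {?m + ?l .. ?m + ?u}"
    using assms
    by (simp add: pred_interval_def order_stat_def Let_def residual_def kth_smallest_def
        atLeastAtMost_def atLeast_def atMost_def Int_def)
  moreover have "emeasure lborel {?m + ?l .. ?m + ?u} = ennreal (?u - ?l)"
    by (cases "?l \<le> ?u") (auto simp: ennreal_neg)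
  ultimately show ?thesis by (simp add: sq_spread_def)
qed

text \<open>Component \<open>i\<close> of \<open>B *v S t \<omega>\<close> is the pairing with row
  \<open>i\<close> of \<open>B\<close>, so \<open>law\<close> applies with that row as direction. A
  general \<open>B\<close> covers both runs.\<close>

lemma nn_integral_weighted_sq_spread:
  fixes S :: "nat \<Rightarrow> 'a \<Rightarrow> real ^ 'm" and B :: "real ^ 'm ^ 'm"
  assumes M: "prob_space M" and D: "finite D" "p < card D" "q < card D"
    and indep: "prob_space.indep_vars M (\<lambda>_. borel) S D"
    and G: "prob_space G" "sets G = sets borel"
    and law: "\<And>t b. t \<in> D \<Longrightarrow> distr (distr M borel (S t)) borel (\<lambda>v. b \<bullet> v)
        = distr G borel (\<lambda>u. b \<bullet> c + sqrt (\<Sum>l<k. (b \<bullet> e l)\<^sup>2) * u)"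
    and w: "\<And>i. 0 < w $ i"
  shows "(\<integral>\<^sup>+ \<omega>. (\<Sum>i\<in>UNIV. ennreal (w $ i) * sq_spread D p q (\<lambda>t. (B *v S t \<omega>) $ i)) \<partial>M)
       = ennreal (\<Sum>l<k. \<Sum>i\<in>UNIV. w $ i * ((B *v e l) $ i)\<^sup>2)
           * (\<integral>\<^sup>+ s. sq_spread D p q s \<partial>PiM D (\<lambda>_. G))"
proof -
  interpret prob_space M by fact
  let ?Q = "\<integral>\<^sup>+ s. sq_spread D p q s \<partial>PiM D (\<lambda>_. G)"
  have S [measurable]: "S t \<in> borel_measurable M" if "t \<in> D" for t
    using indep that by (auto simp: indep_vars_def)
  have comp: "(B *v v) $ i = B $ i \<bullet> v" for v i
    by (rule matrix_vector_mul_component)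
  have meas: "(\<lambda>\<omega>. sq_spread D p q (\<lambda>t. (B *v S t \<omega>) $ i)) \<in> borel_measurable M" for i
  proof -
    have "(\<lambda>\<omega>. \<lambda>t\<in>D. B $ i \<bullet> S t \<omega>) \<in> measurable M (PiM D (\<lambda>_. borel))" by measurable
    then have "(\<lambda>\<omega>. sq_spread D p q (\<lambda>t\<in>D. B $ i \<bullet> S t \<omega>)) \<in> borel_measurable M"
      using borel_measurable_sq_spread[OF D] by (rule measurable_compose)
    also have "(\<lambda>\<omega>. sq_spread D p q (\<lambda>t\<in>D. B $ i \<bullet> S t \<omega>))
        = (\<lambda>\<omega>. sq_spread D p q (\<lambda>t. (B *v S t \<omega>) $ i))"
      unfolding comp by (intro ext sq_spread_cong D) simp
    finally show ?thesis .
  qed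
  have int: "(\<integral>\<^sup>+ \<omega>. sq_spread D p q (\<lambda>t. (B *v S t \<omega>) $ i) \<partial>M)
      = ennreal (\<Sum>l<k. ((B *v e l) $ i)\<^sup>2) * ?Q" for i
  proof -
    have "indep_vars (\<lambda>_. borel) (\<lambda>t \<omega>. B $ i \<bullet> S t \<omega>) D"
      using indep_vars_compose2[OF indep, of "\<lambda>_ v. B $ i \<bullet> v" "\<lambda>_. borel"] by simp
    moreover have "distr M borel (\<lambda>\<omega>. B $ i \<bullet> S t \<omega>)
        = distr G borel (\<lambda>u. B $ i \<bullet> c + sqrt (\<Sum>l<k. (B $ i \<bullet> e l)\<^sup>2) * u)" if "t \<in> D" for t
      using law[OF that, of "B $ i"] S[OF that] by (simp add: distr_distr comp_def)
    ultimately show ?thesis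
      unfolding comp
      by (subst nn_integral_iid_sq_spread[OF M D _ G]) (auto simp: sum_nonneg)
  qed
  \<comment> \<open>Linearity treats the components one at a time, so they may depend on each
    other.\<close>
  have "(\<integral>\<^sup>+ \<omega>. (\<Sum>i\<in>UNIV. ennreal (w $ i) * sq_spread D p q (\<lambda>t. (B *v S t \<omega>) $ i)) \<partial>M)
      = (\<Sum>i\<in>UNIV. ennreal (w $ i) * (ennreal (\<Sum>l<k. ((B *v e l) $ i)\<^sup>2) * ?Q))"
    using meas by (simp add: nn_integral_sum nn_integral_cmult int)
  also have "\<dots> = (\<Sum>i\<in>UNIV. ennreal (w $ i * (\<Sum>l<k. ((B *v e l) $ i)\<^sup>2)) * ?Q)"
    using w by (intro sum.cong) (auto simp: ennreal_mult sum_nonneg less_imp_le mult.assoc)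
  \<comment> \<open>The common factor is pulled out in \<open>ennreal\<close>, where it may be
    infinite.\<close>
  also have "\<dots> = ennreal (\<Sum>i\<in>UNIV. w $ i * (\<Sum>l<k. ((B *v e l) $ i)\<^sup>2)) * ?Q"
    using w by (simp add: sum_distrib_right[symmetric] sum_ennreal sum_nonneg less_imp_le)
  also have "(\<Sum>i\<in>UNIV. w $ i * (\<Sum>l<k. ((B *v e l) $ i)\<^sup>2))
      = (\<Sum>l<k. \<Sum>i\<in>UNIV. w $ i * ((B *v e l) $ i)\<^sup>2)"
    unfolding sum_distrib_left by (rule sum.swap)
  finally show ?thesis .
qed

section \<open>Comparison of the projected and the plain run\<close>

theorem theorem3:
  fixes M :: "'a measure"
    and Hsub :: "real ^ 'n ^ 'k"
    and H :: "real ^ 'n ^ ('n + 'k)"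
    and x :: "nat \<Rightarrow> 'a \<Rightarrow> real ^ 'd"
    and y :: "nat \<Rightarrow> 'a \<Rightarrow> real ^ ('n + 'k)"
    and obs :: "'a \<Rightarrow> nat \<Rightarrow> ('d, 'n + 'k) obs"
    and T :: nat
    and Dtrain Dcalib :: "nat set"
    and A :: "('d, 'n + 'k) algorithm"
    and res :: "nat \<Rightarrow> 'a \<Rightarrow> real ^ ('n + 'k)"
    and \<alpha> :: real
    and w :: "real ^ ('n + 'k)"
  assumes "prob_space M"
    and "CARD('n) \<ge> 2"
    and H_def: "H = struct_mat Hsub"
    and "\<And>t. t \<in> {1..T + 1} \<Longrightarrow> x t \<in> borel_measurable M"
    and "\<And>t. t \<in> {1..T + 1} \<Longrightarrow> y t \<in> borel_measurable M"
    and coherent: "\<And>t. t \<in> {1..T + 1} \<Longrightarrow> AE \<omega> in M. y t \<omega> \<in> range (\<lambda>v. H *v v)"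
    and "Dtrain \<union> Dcalib = {1..T}" and "Dtrain \<inter> Dcalib = {}"
    and "0 < \<alpha>" and "\<alpha> < 1"
    and "\<And>i. w $ i > 0"
    and obs_def: "\<And>\<omega> t. obs \<omega> t = (x t \<omega>, y t \<omega>)"
    and res_def: "\<And>t \<omega>. res t \<omega> = residual (fit A Dtrain (obs \<omega>)) (obs \<omega> t)"
    and indep: "prob_space.indep_vars M (\<lambda>_. borel) res (Dcalib \<union> {T + 1})"
    and ident: "\<And>s t. s \<in> Dcalib \<union> {T + 1} \<Longrightarrow> t \<in> Dcalib \<union> {T + 1} \<Longrightarrow>
                  distr M borel (res s) = distr M borel (res t)"
    and ellip: "\<And>t. t \<in> Dcalib \<Longrightarrow> elliptical (distr M borel (res t))"
  shows "expected_weighted_sq_length M w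
           (\<lambda>\<omega>. pred_interval \<alpha> Dtrain Dcalib A (proj_mat H w) (obs \<omega>) (x (T + 1) \<omega>))
       \<le> expected_weighted_sq_length M w
           (\<lambda>\<omega>. pred_interval \<alpha> Dtrain Dcalib A (mat 1) (obs \<omega>) (x (T + 1) \<omega>))"
proof -
  interpret prob_space M by fact
  have w: "\<And>i. 0 < w $ i" by fact
  have "Dcalib \<subseteq> {1..T}" using \<open>Dtrain \<union> Dcalib = {1..T}\<close> by blast
  then have fin: "finite Dcalib" and sub: "Dcalib \<subseteq> {1..T + 1}"
    by (auto intro: finite_subset)
  let ?P = "proj_mat H w"
  show ?thesis
    using \<open>0 < \<alpha>\<close> \<open>\<alpha> < 1\<close>
  proof (cases rule: ranks_cases[of _ "card Dcalib"])
    case unbounded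
    then show ?thesis
      by (simp add: expected_weighted_sq_length_def pred_interval_unbounded)
  next
    case bounded
    define p q where "p = lower_rank \<alpha> (card Dcalib) - 1" and "q = upper_rank \<alpha> (card Dcalib) - 1"
    have pq: "p < card Dcalib" "q < card Dcalib" using bounded by (auto simp: p_def q_def)
    \<comment> \<open>A positive rank not exceeding the cardinality forces the calibration set to be
      nonempty.\<close>
    then obtain t0 where t0: "t0 \<in> Dcalib" by fastforce
    obtain k c and e :: "nat \<Rightarrow> real ^ ('n + 'k)" and G :: "real measure"
      where G: "prob_space G" "sets G = sets borel"
      and law0: "\<And>b. distr (distr M borel (res t0)) borel (\<lambda>v. b \<bullet> v)
          = distr G borel (\<lambda>u. b \<bullet> c + sqrt (\<Sum>l<k. (b \<bullet> e l)\<^sup>2) * u)"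
      by (rule elliptical_linear_law[OF ellip[OF t0]]) (rule that; assumption)
    \<comment> \<open>The elliptical representation is fixed at \<open>t0\<close> and carried to the
      other indices by equality of laws, so that \<open>c\<close>, \<open>e\<close> and
      \<open>G\<close> are common to all of them.\<close>
    have law: "distr (distr M borel (res t)) borel (\<lambda>v. b \<bullet> v)
          = distr G borel (\<lambda>u. b \<bullet> c + sqrt (\<Sum>l<k. (b \<bullet> e l)\<^sup>2) * u)" if "t \<in> Dcalib" for t b
      using law0 ident[of t t0] that t0 by simp
    have indep': "indep_vars (\<lambda>_. borel) res Dcalib"
      using indep by (rule indep_vars_subset) auto
    let ?Q = "\<integral>\<^sup>+ s. sq_spread Dcalib p q s \<partial>PiM Dcalib (\<lambda>_. G)"
    have inv: "invertible (transpose H ** diag_mat w ** H)"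
    proof (rule invertible_weighted_gram[OF w])
      show "v = 0" if "H *v v = 0" for v
        using that struct_mat_mult_Inl[of Hsub v] by (simp add: H_def vec_eq_iff)
    qed
    have "AE \<omega> in M. \<forall>t\<in>Dcalib. y t \<omega> \<in> range (\<lambda>v. H *v v)"
      using fin coherent sub by (intro AE_finite_allI) auto
    \<comment> \<open>Since \<open>?P\<close> fixes \<open>y t \<omega>\<close>, projecting the
      forecast alone amounts to projecting the whole residual.\<close>
    then have ae: "AE \<omega> in M. \<forall>t\<in>Dcalib. y t \<omega> - ?P *v fit A Dtrain (obs \<omega>) (x t \<omega>) = ?P *v res t \<omega>"
    proof eventually_elim
      case (elim \<omega>)
      then have "?P *v y t \<omega> = y t \<omega>" if "t \<in> Dcalib" for t
        using that proj_mat_fixes_range[OF inv] by auto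
      then show ?case
        by (simp add: res_def obs_def residual_def matrix_vector_mult_diff_distrib)
    qed
    \<comment> \<open>Used with \<open>?P\<close> and with \<open>mat 1\<close>; the two results
      share the factor \<open>?Q\<close> and differ only in the weighted norms of the vectors
      \<open>B *v e l\<close>.\<close>
    have len: "expected_weighted_sq_length M w
           (\<lambda>\<omega>. pred_interval \<alpha> Dtrain Dcalib A B (obs \<omega>) (x (T + 1) \<omega>))
        = ennreal (\<Sum>l<k. \<Sum>i\<in>UNIV. w $ i * ((B *v e l) $ i)\<^sup>2) * ?Q"
      if B: "AE \<omega> in M. \<forall>t\<in>Dcalib. y t \<omega> - B *v fit A Dtrain (obs \<omega>) (x t \<omega>) = B *v res t \<omega>" for B
    proof -
      have "expected_weighted_sq_length M w
           (\<lambda>\<omega>. pred_interval \<alpha> Dtrain Dcalib A B (obs \<omega>) (x (T + 1) \<omega>))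
         = (\<integral>\<^sup>+ \<omega>. (\<Sum>i\<in>UNIV. ennreal (w $ i) * sq_spread Dcalib p q
             (\<lambda>t. (y t \<omega> - B *v fit A Dtrain (obs \<omega>) (x t \<omega>)) $ i)) \<partial>M)"
        using bounded by (simp add: expected_weighted_sq_length_def emeasure_pred_interval p_def q_def obs_def)
      also have "\<dots> = (\<integral>\<^sup>+ \<omega>. (\<Sum>i\<in>UNIV. ennreal (w $ i) * sq_spread Dcalib p q
             (\<lambda>t. (B *v res t \<omega>) $ i)) \<partial>M)"
      proof (intro nn_integral_cong_AE, use B in eventually_elim)
        case (elim \<omega>)
        then have "sq_spread Dcalib p q (\<lambda>t. (y t \<omega> - B *v fit A Dtrain (obs \<omega>) (x t \<omega>)) $ i)
            = sq_spread Dcalib p q (\<lambda>t. (B *v res t \<omega>) $ i)" for i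
          by (intro sq_spread_cong[OF fin]) metis
        then show ?case by simp
      qed
      also have "\<dots> = ennreal (\<Sum>l<k. \<Sum>i\<in>UNIV. w $ i * ((B *v e l) $ i)\<^sup>2) * ?Q"
        by (rule nn_integral_weighted_sq_spread[OF \<open>prob_space M\<close> fin pq indep' G]) (rule law w; assumption?)+
      finally show ?thesis .
    qed
    \<comment> \<open>The weighted contraction is applied to each column \<open>e l\<close>
      separately.\<close>
    have "(\<Sum>l<k. \<Sum>i\<in>UNIV. w $ i * ((?P *v e l) $ i)\<^sup>2) \<le> (\<Sum>l<k. \<Sum>i\<in>UNIV. w $ i * (e l $ i)\<^sup>2)"
      by (intro sum_mono proj_mat_contraction[OF inv w])
    \<comment> \<open>Multiplication by \<open>?Q\<close> is monotone in \<open>ennreal\<close> even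
      when \<open>?Q\<close> is infinite.\<close>
    then show ?thesis
      using len[OF ae] len[of "mat 1"]
      by (simp add: res_def obs_def residual_def ennreal_leI mult_right_mono)
  qed
qed

end
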